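(* Let $M\ge 3$ be an odd integer, let $\chi\in(0,1]$ and let $\bar q_2\in\mathbb{R}$ and $\bar\theta^W\in\mathbb{R}$ be given constants. With the matrices and vectors defined in the context, the linear system $$\bar q_2\, c_r+ E\begin{bmatrix}0& \\ &M_0\end{bmatrix}\begin{bmatrix}\bar\theta(0)-\bar\theta^W \\ R_{\rm odd}\,\hat v_+(0)\end{bmatrix}=b(\chi)\,E\,T\begin{bmatrix}\bar\theta(0)-\bar\theta^W \\ R_{\rm even}\,\hat v_+(0)\end{bmatrix}$$ has a unique solution $(\bar\theta(0),\hat v_+(0))\in\mathbb{R}\times\mathbb{R}^{m_o}$.
   Context: Notation. For an integer $M\ge3$ put $m_o=2\lfloor\frac{M-1}{2}\rfloor-1$ and $m_e=2\lfloor\frac M2\rfloor-1$. $\mathrm{He}_n$ is the $n$-th probabilists' Hermite polynomial, and for $\alpha\in\mathbb{N}^3$, $\mathrm{He}_\alpha(\xi)=\prod_{i=1}^3\mathrm{He}_{\alpha_i}(\xi_i)$. $e_1,e_2,e_3$ is the standard basis, $\bar\omega(\xi)=(2\pi)^{-3/2}e^{-|\xi|^2/2}$ on $\mathbb{R}^3$, and $\langle p,q\rangle_{\bar\omega}=\int_{\mathbb{R}^3}pq\,\bar\omega\,d\xi$. Polynomials: $\phi_1=\mathrm{He}_{2e_2}-\frac12(\mathrm{He}_{2e_1}+\mathrm{He}_{2e_3})$, and for $1\le k\le (m_e-1)/2$: $\phi_{2k}=\mathrm{He}_{(2k+2)e_2}$, $\phi_{2k+1}=\frac12(\mathrm{He}_{2e_1+2ke_2}+\mathrm{He}_{2e_3+2ke_2})$.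 $\varphi_1=\mathrm{He}_{3e_2}-\frac32(\mathrm{He}_{2e_1+e_2}+\mathrm{He}_{2e_3+e_2})$, and for $1\le k\le(m_o-1)/2$: $\varphi_{2k}=\mathrm{He}_{(2k+3)e_2}$, $\varphi_{2k+1}=\frac12(\mathrm{He}_{2e_1+(2k+1)e_2}+\mathrm{He}_{2e_3+(2k+1)e_2})$. Matrices: $a_i=\sqrt{\langle\phi_i,\phi_i\rangle_{\bar\omega}}$, $b_j=\sqrt{\langle\varphi_j,\varphi_j\rangle_{\bar\omega}}$, $L_1=\mathrm{diag}(a_1,\dots,a_{m_e})$, $M_0=(m^0_{ij})\in\mathbb{R}^{m_e\times m_o}$ with $m^0_{ij}=\frac{1}{a_ib_j}\langle\phi_i,\xi_2\varphi_j\rangle_{\bar\omega}$. The symmetric matrix $\mathbf M=\begin{bmatrix}0&M_0 \\ M_0^T&0\end{bmatrix}$ has an orthogonal diagonalization $\mathbf M R=R\Lambda$ with $R$ orthogonal, $$R=\begin{bmatrix}R_{\rm even}&R_0&R_{\rm even} \\ R_{\rm odd}&0&-R_{\rm odd}\end{bmatrix},\qquad \Lambda=\mathrm{diag}(\Lambda_+,0_{m_e-m_o},-\Lambda_+),$$ $R_{\rm even}\in\mathbb{R}^{m_e\times m_o}$, $R_{\rm odd}\in\mathbb{R}^{m_o\times m_o}$, $R_0\in\mathbb{R}^{m_e\times(m_e-m_o)}$, $\Lambda_+$ diagonal with positive diagonal entries in nonincreasing order; such a diagonalization is fixed. $S(\alpha,\beta)=\int_{-\infty}^0\xi\,\mathrm{He}_\alpha(\xi)\mathrm{He}_\beta(\xi)e^{-\xi^2/2}d\xi$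 for $\alpha,\beta\in\mathbb{N}$. $T^b=(t^b_{ij})\in\mathbb{R}^{(m_e+1)\times(m_e+1)}$ has nonzero entries only at positions with $i\equiv j\pmod 2$: $t^b_{2k,2l}=S(2k-2,2l-2)$ and $t^b_{2k-1,2l-1}=S(2k,2l)-\frac{S(2k,0)}{S(0,0)}S(0,2l)$, $k,l\ge1$. With $P_1=\begin{bmatrix}0.5&1 \\ 1&-1\end{bmatrix}$, $$T=\begin{bmatrix}1& \\ &L_1^{-1}\end{bmatrix}\begin{bmatrix}P_1& \\ &I_{m_e-1}\end{bmatrix}T^b\begin{bmatrix}P_1& \\ &I_{m_e-1}\end{bmatrix}\begin{bmatrix}1& \\ &L_1^{-1}\end{bmatrix}.$$ $E=[I_{m_o+1},0]\in\mathbb{R}^{(m_o+1)\times(m_e+1)}$ (the identity when $M$ is odd); in the claim, $\begin{bmatrix}0& \\ &M_0\end{bmatrix}$ is the block-diagonal $(m_e+1)\times(m_o+1)$ matrix with first block the scalar $0$. $c_r=(1,\frac{4}{5\sqrt3},\frac{2\sqrt6}{5},\frac{2\sqrt2}{5},0,\dots,0)^T\in\mathbb{R}^{m_o+1}$ (truncated to its first two entries if $M=3$). $b(\chi)=\frac{2\chi}{2-\chi}(2\pi)^{-1/2}$. *)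

theory Defs
  imports
    "HOL-Analysis.Analysis"
    "Jordan_Normal_Form.Matrix"
    "Jordan_Normal_Form.Gauss_Jordan_Elimination"
begin

text \<open>
  The size of the system depends on the natural number \<open>M\<close>, so its matrices and vectors are those
  of \<open>Jordan_Normal_Form\<close>, which are indexed from 0; the velocity space is \<open>real ^ 3\<close>, and multi-indices
  are elements of \<open>nat ^ 3\<close>. The families \<open>phi\<close> and \<open>psi\<close> are indexed from 1.
\<close>

hide_const (open) Finite_Cartesian_Product.vec Finite_Cartesian_Product.row
  Finite_Cartesian_Product.mat Determinants.det

definition m_odd :: "nat \<Rightarrow> nat" where
  "m_odd M = 2 * ((M - 1) div 2) - 1"

definition m_even :: "nat \<Rightarrow> nat" where
  "m_even M = 2 * (M div 2) - 1"

fun He :: "nat \<Rightarrow> real \<Rightarrow> real" where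
  "He 0 x = 1"
| "He (Suc 0) x = x"
| "He (Suc (Suc n)) x = x * He (Suc n) x - real (Suc n) * He n x"

definition He3 :: "nat ^ 3 \<Rightarrow> real ^ 3 \<Rightarrow> real" where
  "He3 \<alpha> \<xi> = (\<Prod>i\<in>UNIV. He (vec_nth \<alpha> i) (vec_nth \<xi> i))"

definition maxwellian :: "real ^ 3 \<Rightarrow> real" where
  "maxwellian \<xi> = (2 * pi) powr (- 3 / 2) * exp (- (norm \<xi>)\<^sup>2 / 2)"

definition ip :: "(real ^ 3 \<Rightarrow> real) \<Rightarrow> (real ^ 3 \<Rightarrow> real) \<Rightarrow> real" where
  "ip p q = (LINT \<xi>|lborel. p \<xi> * q \<xi> * maxwellian \<xi>)"

text \<open>In the next two definitions \<open>axis i n\<close> is the multi-index \<open>n e\<^sub>i\<close>. The even and odd cases for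
  \<open>i \<ge> 2\<close> are \<open>i = 2k\<close> and \<open>i = 2k + 1\<close> with \<open>k \<ge> 1\<close>; the value at \<open>i = 0\<close> is never used.
  \<open>psi\<close> is the family written with the letter varphi, of odd degree in \<open>\<xi>\<^sub>2\<close>.\<close>

definition phi :: "nat \<Rightarrow> real ^ 3 \<Rightarrow> real" where
  "phi i \<xi> =
    (let k = i div 2 in
     if i = 1 then
       He3 (axis 2 2) \<xi> - 1 / 2 * (He3 (axis 1 2) \<xi> + He3 (axis 3 2) \<xi>)
     else if even i then
       He3 (axis 2 (2 * k + 2)) \<xi>
     else
       1 / 2 * (He3 (axis 1 2 + axis 2 (2 * k)) \<xi> + He3 (axis 3 2 + axis 2 (2 * k)) \<xi>))"

definition psi :: "nat \<Rightarrow> real ^ 3 \<Rightarrow> real" where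
  "psi j \<xi> =
    (let k = j div 2 in
     if j = 1 then
       He3 (axis 2 3) \<xi> - 3 / 2 * (He3 (axis 1 2 + axis 2 1) \<xi> + He3 (axis 3 2 + axis 2 1) \<xi>)
     else if even j then
       He3 (axis 2 (2 * k + 3)) \<xi>
     else
       1 / 2 * (He3 (axis 1 2 + axis 2 (2 * k + 1)) \<xi> + He3 (axis 3 2 + axis 2 (2 * k + 1)) \<xi>))"

definition acoef :: "nat \<Rightarrow> real" where
  "acoef i = sqrt (ip (phi i) (phi i))"

definition bcoef :: "nat \<Rightarrow> real" where
  "bcoef j = sqrt (ip (psi j) (psi j))"

definition L1 :: "nat \<Rightarrow> real mat" where
  "L1 M = mat_diag (m_even M) (\<lambda>i. acoef (i + 1))"

definition m0 :: "nat \<Rightarrow> nat \<Rightarrow> real" where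
  "m0 i j = 1 / (acoef i * bcoef j) * ip (phi i) (\<lambda>\<xi>. vec_nth \<xi> 2 * psi j \<xi>)"

definition M0 :: "nat \<Rightarrow> real mat" where
  "M0 M = Matrix.mat (m_even M) (m_odd M) (\<lambda>(i, j). m0 (i + 1) (j + 1))"

definition MM :: "nat \<Rightarrow> real mat" where
  "MM M = four_block_mat
    (0\<^sub>m (m_even M) (m_even M)) (M0 M)
    (transpose_mat (M0 M)) (0\<^sub>m (m_odd M) (m_odd M))"

definition hcat :: "real mat \<Rightarrow> real mat \<Rightarrow> real mat" where
  "hcat A B = four_block_mat A B (0\<^sub>m 0 (dim_col A)) (0\<^sub>m 0 (dim_col B))"

text \<open>The left column block of \<open>four_block_mat\<close> holds the first two block columns of \<open>R\<close>.
  For odd \<open>M\<close> the block \<open>R0\<close> has no columns.\<close>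

definition R_mat :: "nat \<Rightarrow> real mat \<Rightarrow> real mat \<Rightarrow> real mat \<Rightarrow> real mat" where
  "R_mat M Reven Rodd R0 = four_block_mat
    (hcat Reven R0)                                   Reven
    (hcat Rodd (0\<^sub>m (m_odd M) (m_even M - m_odd M)))  (- Rodd)"

definition Lambda_mat :: "nat \<Rightarrow> real mat \<Rightarrow> real mat" where
  "Lambda_mat M Lp = diag_block_mat [Lp, 0\<^sub>m (m_even M - m_odd M) (m_even M - m_odd M), - Lp]"

text \<open>Note that \<open>orthogonal_mat\<close> of \<open>Jordan_Normal_Form\<close> does not ask for columns of norm 1.\<close>

definition is_diagonalization ::
  "nat \<Rightarrow> real mat \<Rightarrow> real mat \<Rightarrow> real mat \<Rightarrow> real mat \<Rightarrow> bool" where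
  "is_diagonalization M Reven Rodd R0 Lp \<longleftrightarrow>
    Reven \<in> carrier_mat (m_even M) (m_odd M) \<and>
    Rodd \<in> carrier_mat (m_odd M) (m_odd M) \<and>
    R0 \<in> carrier_mat (m_even M) (m_even M - m_odd M) \<and>
    Lp \<in> carrier_mat (m_odd M) (m_odd M) \<and>
    diagonal_mat Lp \<and>
    (\<forall>i<m_odd M. 0 < Lp $$ (i, i)) \<and>
    (\<forall>i j. i \<le> j \<and> j < m_odd M \<longrightarrow> Lp $$ (j, j) \<le> Lp $$ (i, i)) \<and>
    (let R = R_mat M Reven Rodd R0 in
      transpose_mat R * R = 1\<^sub>m (m_even M + m_odd M) \<and>
      R * transpose_mat R = 1\<^sub>m (m_even M + m_odd M) \<and>
      MM M * R = R * Lambda_mat M Lp)"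

definition S :: "nat \<Rightarrow> nat \<Rightarrow> real" where
  "S \<alpha> \<beta> = (LINT \<xi>:{..0}|lborel. \<xi> * He \<alpha> \<xi> * He \<beta> \<xi> * exp (- \<xi>\<^sup>2 / 2))"

text \<open>The entry at the (1-based) position \<open>(i, j)\<close>: \<open>i = 2k, j = 2l\<close> in the first case and
  \<open>i = 2k - 1, j = 2l - 1\<close> in the second.\<close>

definition tb :: "nat \<Rightarrow> nat \<Rightarrow> real" where
  "tb i j =
    (if even i \<and> even j then S (i - 2) (j - 2)
     else if odd i \<and> odd j then S (i + 1) (j + 1) - S (i + 1) 0 / S 0 0 * S 0 (j + 1)
     else 0)"

definition Tb :: "nat \<Rightarrow> real mat" where
  "Tb M = Matrix.mat (m_even M + 1) (m_even M + 1) (\<lambda>(i, j). tb (i + 1) (j + 1))"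

definition P1 :: "real mat" where
  "P1 = mat_of_rows_list 2 [[1 / 2, 1], [1, - 1]]"

text \<open>\<open>mat_inverse\<close> returns an option; \<open>L1 M\<close> is invertible because every \<open>acoef i\<close> used is positive.\<close>

definition T_mat :: "nat \<Rightarrow> real mat" where
  "T_mat M =
    (let D = diag_block_mat [1\<^sub>m 1, the (mat_inverse (L1 M))];
         P = diag_block_mat [P1, 1\<^sub>m (m_even M - 1)]
     in D * P * Tb M * P * D)"

definition E_mat :: "nat \<Rightarrow> real mat" where
  "E_mat M = hcat (1\<^sub>m (m_odd M + 1)) (0\<^sub>m (m_odd M + 1) (m_even M - m_odd M))"

definition c_r :: "nat \<Rightarrow> real Matrix.vec" where
  "c_r M = Matrix.vec (m_odd M + 1) (\<lambda>i.
    if i = 0 then 1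
    else if i = 1 then 4 / (5 * sqrt 3)
    else if i = 2 then 2 * sqrt 6 / 5
    else if i = 3 then 2 * sqrt 2 / 5
    else 0)"

definition b_coef :: "real \<Rightarrow> real" where
  "b_coef chi = 2 * chi / (2 - chi) * (2 * pi) powr (- 1 / 2)"

end

theory Submission
  imports Defs "HOL-Probability.Distributions" "Jordan_Normal_Form.Determinant"
begin

text \<open>
  For odd \<open>M\<close> the system is square and \<open>E\<close> is the identity. Orthogonality of \<open>R\<close> gives
  \<open>Reven\<^sup>T Reven = 1/2\<close>, and \<open>MM R = R \<Lambda>\<close> gives \<open>M0 Rodd = Reven \<Lambda>\<^sub>+\<close>. Pair the homogeneous
  equation \<open>b T y = (0, M0 Rodd v)\<close>, where \<open>y = (t, Reven v)\<close>, with \<open>y\<close>: the right-hand side becomes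
  \<open>1/2 v \<bullet> \<Lambda>\<^sub>+ v \<ge> 0\<close>, while \<open>T\<close> is negative semidefinite, being congruent to \<open>T\<^sup>b\<close>, whose two
  parity blocks are Gram matrices of the nonpositive form \<open>\<integral> \<xi> f g e\<^bsup>-\<xi>\<^sup>2/2\<^esup>\<close> on the negative
  half-line. So both sides vanish, whence \<open>v = 0\<close>; then \<open>t = 0\<close> because
  the first diagonal entry \<open>t\<^sup>b\<^sub>1\<^sub>1/4 + S(0,0)\<close> of \<open>T\<close> is negative.
\<close>

section \<open>Gaussian integrability of functions of polynomial growth\<close>

text \<open>This class stands in for polynomial functions: it contains the constants and the linear
  functionals, it is closed under sums and products, and each member is integrable against the
  Gaussian. Continuity supplies measurability; the base \<open>1 + (norm x)\<^sup>2\<close> is at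
  least 1, so bounds with different exponents can be compared.\<close>

definition poly_growth :: "('a::euclidean_space \<Rightarrow> real) \<Rightarrow> bool" where
  "poly_growth f \<longleftrightarrow> continuous_on UNIV f \<and> (\<exists>C N. \<forall>x. \<bar>f x\<bar> \<le> C * (1 + (norm x)\<^sup>2) ^ N)"

lemma poly_growthI:
  assumes "continuous_on UNIV f" "\<And>x. \<bar>f x\<bar> \<le> C * (1 + (norm x)\<^sup>2) ^ N"
  shows "poly_growth f"
  using assms unfolding poly_growth_def by blast

lemma poly_growth_const: "poly_growth (\<lambda>x. c)"
  by (rule poly_growthI[where C = "\<bar>c\<bar>" and N = 0]) auto

lemma poly_growth_inner: "poly_growth (\<lambda>x. x \<bullet> b)"
proof (rule poly_growthI[where C = "norm b" and N = 1])
  fix x :: 'a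
  have "norm x * 2 \<le> 1 + (norm x)\<^sup>2"
    using sum_squares_bound[of "norm x" 1] by simp
  then have "norm x \<le> 1 + (norm x)\<^sup>2"
    using norm_ge_zero[of x] by linarith
  then have "norm x * norm b \<le> (1 + (norm x)\<^sup>2) * norm b"
    by (intro mult_right_mono) auto
  with Cauchy_Schwarz_ineq2[of x b] show "\<bar>x \<bullet> b\<bar> \<le> norm b * (1 + (norm x)\<^sup>2) ^ 1"
    by (simp add: mult.commute)
qed (intro continuous_intros)

lemma poly_growth_mult:
  assumes "poly_growth f" "poly_growth g"
  shows "poly_growth (\<lambda>x. f x * g x)"
proof -
  obtain C N C' N' where f: "\<bar>f x\<bar> \<le> C * (1 + (norm x)\<^sup>2) ^ N"
    and g: "\<bar>g x\<bar> \<le> C' * (1 + (norm x)\<^sup>2) ^ N'" for x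
    using assms unfolding poly_growth_def by blast
  show ?thesis
  proof (rule poly_growthI[where C = "C * C'" and N = "N + N'"])
    fix x
    have "\<bar>f x\<bar> * \<bar>g x\<bar> \<le> (C * (1 + (norm x)\<^sup>2) ^ N) * (C' * (1 + (norm x)\<^sup>2) ^ N')"
      using f[of x] g[of x] abs_ge_zero[of "f x"] abs_ge_zero[of "g x"] by (intro mult_mono) linarith+
    then show "\<bar>f x * g x\<bar> \<le> C * C' * (1 + (norm x)\<^sup>2) ^ (N + N')"
      by (simp add: abs_mult power_add mult_ac)
  qed (use assms in \<open>auto simp: poly_growth_def intro!: continuous_intros\<close>)
qed

lemma poly_growth_add:
  fixes f g :: "'a::euclidean_space \<Rightarrow> real"
  assumes "poly_growth f" "poly_growth g"
  shows "poly_growth (\<lambda>x. f x + g x)"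
proof -
  obtain C N C' N' where f: "\<bar>f x\<bar> \<le> C * (1 + (norm x)\<^sup>2) ^ N"
    and g: "\<bar>g x\<bar> \<le> C' * (1 + (norm x)\<^sup>2) ^ N'" for x
    using assms unfolding poly_growth_def by blast
  show ?thesis
  \<comment> \<open>Absolute values of the constants make the raised exponent harmless without first
    deriving their signs.\<close>
  proof (rule poly_growthI[where C = "\<bar>C\<bar> + \<bar>C'\<bar>" and N = "N + N'"])
    fix x :: 'a
    let ?s = "1 + (norm x)\<^sup>2"
    have "C * ?s ^ N \<le> \<bar>C\<bar> * ?s ^ (N + N')" "C' * ?s ^ N' \<le> \<bar>C'\<bar> * ?s ^ (N + N')"
      by (intro mult_mono power_increasing; simp)+
    with f[of x] g[of x] show "\<bar>f x + g x\<bar> \<le> (\<bar>C\<bar> + \<bar>C'\<bar>) * ?s ^ (N + N')"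
      by (simp add: distrib_right)
  qed (use assms in \<open>auto simp: poly_growth_def intro!: continuous_intros\<close>)
qed

lemma poly_growth_diff:
  assumes "poly_growth f" "poly_growth g"
  shows "poly_growth (\<lambda>x. f x - g x)"
  using poly_growth_add[OF assms(1) poly_growth_mult[OF poly_growth_const[of "-1"] assms(2)]] by simp

lemma poly_growth_divide:
  assumes "poly_growth f"
  shows "poly_growth (\<lambda>x. f x / c)"
  using poly_growth_mult[OF assms poly_growth_const[of "1 / c"]] by simp

lemma poly_growth_prod:
  assumes "\<And>i. i \<in> I \<Longrightarrow> poly_growth (f i)"
  shows "poly_growth (\<lambda>x. \<Prod>i\<in>I. f i x)"
  using assms
  by (induction I rule: infinite_finite_induct) (auto intro: poly_growth_const poly_growth_mult)

lemma poly_growth_sum: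
  assumes "\<And>i. i \<in> I \<Longrightarrow> poly_growth (f i)"
  shows "poly_growth (\<lambda>x. \<Sum>i\<in>I. f i x)"
  using assms
  by (induction I rule: infinite_finite_induct) (auto intro: poly_growth_const poly_growth_add)

text \<open>Up to the factor \<open>sqrt (pi / c)\<close> this is the centred normal density of
  variance \<open>1 / (2 * c)\<close>.\<close>

lemma integrable_exp_neg_square:
  assumes "c > 0"
  shows "integrable lborel (\<lambda>x::real. exp (- (c * x\<^sup>2)))"
proof -
  have "integrable lborel (\<lambda>x. sqrt (pi / c) * normal_density 0 (sqrt (1 / (2 * c))) x)"
    by (intro integrable_mult_right integrable_normal_density) (use assms in auto)
  moreover have "sqrt (pi / c) * normal_density 0 (sqrt (1 / (2 * c))) x = exp (- (c * x\<^sup>2))" for x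
    using assms unfolding normal_density_def by (simp add: field_simps real_sqrt_divide)
  ultimately show ?thesis
    by simp
qed

text \<open>The Gaussian factors over the coordinates, so its integral is a finite power of the
  one-dimensional one.\<close>

lemma integrable_exp_neg_norm_square:
  assumes "c > 0"
  shows "integrable lborel (\<lambda>x::'a::euclidean_space. exp (- (c * (norm x)\<^sup>2)))"
proof (rule integrableI_bounded)
  have eq: "ennreal (norm (exp (- (c * (norm x)\<^sup>2)))) = (\<Prod>b\<in>Basis. ennreal (exp (- (c * (x \<bullet> b)\<^sup>2))))"
    for x :: 'a
    unfolding power2_norm_eq_inner
    by (subst euclidean_inner)
      (simp add: prod_ennreal exp_sum[symmetric] sum_distrib_left sum_negf power2_eq_square)
  have "(\<integral>\<^sup>+x. (\<Prod>b\<in>(Basis :: 'a set). ennreal (exp (- (c * (x \<bullet> b)\<^sup>2)))) \<partial>lborel)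
      = (\<Prod>b\<in>(Basis :: 'a set). \<integral>\<^sup>+x. ennreal (exp (- (c * x\<^sup>2))) \<partial>lborel)"
    by (rule nn_integral_lborel_prod[where f = "\<lambda>_ x. ennreal (exp (- (c * x\<^sup>2)))"]) auto
  also have "\<dots> < \<infinity>"
    using nn_integral_eq_integral[OF integrable_exp_neg_square[OF assms]]
    by (simp add: prod_ennreal prod_constant power_less_top_ennreal)
  finally show "(\<integral>\<^sup>+x. ennreal (norm (exp (- (c * (norm (x::'a))\<^sup>2)))) \<partial>lborel) < \<infinity>"
    by (simp only: eq)
qed auto

text \<open>A single term of the exponential series is at most the whole sum, since all terms are
  nonnegative.\<close>

lemma power_le_fact_mult_exp:
  fixes s :: real
  assumes "s \<ge> 0"
  shows "s ^ n \<le> fact n * exp s"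
proof -
  have "(\<Sum>k\<in>{n}. s ^ k /\<^sub>R fact k) \<le> (\<Sum>k. s ^ k /\<^sub>R fact k)"
    using assms by (intro sum_le_suminf summable_exp_generic) auto
  then have "s ^ n / fact n \<le> exp s"
    by (simp add: exp_def divide_inverse mult.commute)
  then show ?thesis
    by (simp add: field_simps)
qed

text \<open>Half of the Gaussian exponent absorbs the polynomial. With
  \<open>s = (norm x)\<^sup>2\<close>, the power \<open>(1 + s) ^ N\<close> is at most
  \<open>4 ^ N * fact N * exp ((1 + s) / 4)\<close>, which leaves the integrable bound
  \<open>exp (- s / 4)\<close> times the constant \<open>?K\<close>.\<close>

lemma integrable_poly_growth:
  fixes f :: "'a::euclidean_space \<Rightarrow> real"
  assumes "poly_growth f"
  shows "integrable lborel (\<lambda>x. f x * exp (- (norm x)\<^sup>2 / 2))"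
proof -
  obtain C N where f: "\<bar>f x\<bar> \<le> C * (1 + (norm x)\<^sup>2) ^ N" for x
    using assms unfolding poly_growth_def by blast
  have C: "C \<ge> 0"
    using f[of 0] by simp
  let ?K = "C * (4 ^ N * fact N * exp (1 / 4))"
  have "integrable lborel (\<lambda>x::'a. ?K * exp (- (1 / 4 * (norm x)\<^sup>2)))"
    by (intro integrable_mult_right integrable_exp_neg_norm_square) simp
  then show ?thesis
  proof (rule Bochner_Integration.integrable_bound)
    have "continuous_on UNIV (\<lambda>x. f x * exp (- (norm x)\<^sup>2 / 2))"
      using assms unfolding poly_growth_def by (intro continuous_intros) auto
    then show "(\<lambda>x. f x * exp (- (norm x)\<^sup>2 / 2)) \<in> borel_measurable lborel"
      by (simp add: borel_measurable_continuous_onI)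
    have "norm (f x * exp (- (norm x)\<^sup>2 / 2)) \<le> ?K * exp (- (1 / 4 * (norm x)\<^sup>2))" for x
    proof -
      let ?s = "(norm x)\<^sup>2"
      have "((1 + ?s) / 4) ^ N \<le> fact N * exp ((1 + ?s) / 4)"
        by (rule power_le_fact_mult_exp) simp
      then have *: "(1 + ?s) ^ N \<le> 4 ^ N * fact N * exp ((1 + ?s) / 4)"
        by (simp add: power_divide field_simps)
      have "\<bar>f x\<bar> \<le> C * (4 ^ N * fact N * exp ((1 + ?s) / 4))"
        using f[of x] mult_left_mono[OF * C] by linarith
      then have "\<bar>f x\<bar> * exp (- ?s / 2) \<le> C * (4 ^ N * fact N * exp ((1 + ?s) / 4)) * exp (- ?s / 2)"
        by (intro mult_right_mono) auto
      also have "\<dots> = C * (4 ^ N * fact N) * exp ((1 + ?s) / 4 + - ?s / 2)"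
        by (simp only: exp_add mult_ac)
      also have "(1 + ?s) / 4 + - ?s / 2 = 1 / 4 + - (1 / 4 * ?s)"
        by (simp add: field_simps)
      also have "C * (4 ^ N * fact N) * exp (1 / 4 + - (1 / 4 * ?s)) = ?K * exp (- (1 / 4 * ?s))"
        by (simp only: exp_add mult_ac)
      finally show ?thesis
        by (simp add: abs_mult)
    qed
    then show "AE x in lborel. norm (f x * exp (- (norm x)\<^sup>2 / 2))
        \<le> norm (?K * exp (- (1 / 4 * (norm x)\<^sup>2)))"
      using C by (auto intro!: AE_I2 simp: abs_mult)
  qed
qed

text \<open>The complement is open and null, hence empty. This turns almost everywhere statements
  into pointwise ones.\<close>

lemma closed_AE_lborel_mem:
  fixes C :: "'a::euclidean_space set"
  assumes "closed C" "AE x in lborel. x \<in> C"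
  shows "x \<in> C"
  using mem_closed_if_AE_lebesgue[OF assms(1)] AE_completion[OF assms(2)] by auto

lemma integral_pos_if_continuous:
  fixes f :: "'a::euclidean_space \<Rightarrow> real"
  assumes "continuous_on UNIV f" "integrable lborel f" "\<And>x. f x \<ge> 0" "f x0 \<noteq> 0"
  shows "integral\<^sup>L lborel f > 0"
proof (rule ccontr)
  assume "\<not> ?thesis"
  moreover have "integral\<^sup>L lborel f \<ge> 0"
    using assms(3) by (simp add: integral_nonneg_AE)
  ultimately have "AE x in lborel. f x = 0"
    using integral_nonneg_eq_0_iff_AE[OF assms(2)] assms(3) by simp
  then have "AE x in lborel. x \<in> {x. f x = 0}"
    by simp
  moreover have "closed {x. f x = 0}"
    using assms(1) by (intro closed_Collect_eq continuous_on_const)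
  ultimately have "x0 \<in> {x. f x = 0}"
    by (rule closed_AE_lborel_mem[rotated])
  with assms(4) show False
    by simp
qed

section \<open>Hermite polynomials and positivity of the norms \<open>acoef\<close>\<close>

lemma poly_growth_id: "poly_growth (\<lambda>x::real. x)"
  using poly_growth_inner[of "1::real"] by simp

lemma poly_growth_He:
  assumes "poly_growth g"
  shows "poly_growth (\<lambda>x. He n (g x))"
  using assms
  by (induction n "0::real" rule: He.induct)
    (auto intro!: poly_growth_const poly_growth_diff poly_growth_mult)

lemma poly_growth_He3: "poly_growth (He3 \<alpha>)"
  unfolding He3_def[abs_def] cart_eq_inner_axis[of "_ :: real ^ 3"]
  by (intro poly_growth_prod poly_growth_He poly_growth_inner)

text \<open>For \<open>x \<ge> n\<close> the values \<open>He 0 x\<close>, ...,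
  \<open>He n x\<close> are nondecreasing and start at 1: in the recursion,
  \<open>x \<ge> k + 2\<close> outweighs the coefficient \<open>k + 1\<close> by at least 1. This
  gives explicit points that are not zeros of \<open>He n\<close>.\<close>

lemma He_ge_1:
  assumes "x \<ge> real n"
  shows "He n x \<ge> 1"
proof -
  have "1 \<le> He n x \<and> He n x \<le> He (Suc n) x" if "x \<ge> real (Suc n)" for n
    using that
  proof (induction n)
    case (Suc n)
    have "real (Suc n) * He n x \<le> real (Suc n) * He (Suc n) x"
      using Suc by (intro mult_left_mono) auto
    moreover have "real (Suc (Suc n)) * He (Suc n) x \<le> x * He (Suc n) x"
      using Suc by (intro mult_right_mono) auto
    ultimately have "He (Suc n) x \<le> He (Suc (Suc n)) x"
      by (simp add: algebra_simps)
    with Suc show ?case by auto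
  qed simp
  with assms show ?thesis by (cases n) force+
qed

lemma poly_growth_phi: "poly_growth (phi i)"
  unfolding phi_def[abs_def] Let_def
  by (cases "i = 1"; cases "even i")
    (auto intro!: poly_growth_He3 poly_growth_add poly_growth_diff poly_growth_divide
      simp del: One_nat_def)

lemma vec_nth_axis: "vec_nth (axis i a) j = (if j = i then a else 0)"
  by (simp add: axis_def)

lemma He3_axis: "He3 (axis i n) \<xi> = He n (vec_nth \<xi> i)"
proof -
  have "He3 (axis i n) \<xi> = (\<Prod>j\<in>UNIV. if j = i then He n (vec_nth \<xi> i) else 1)"
    unfolding He3_def by (intro prod.cong) (auto simp: axis_def)
  then show ?thesis
    by simp
qed

lemma He3_axis_add:
  assumes "i \<noteq> j"
  shows "He3 (axis i m + axis j n) \<xi> = He m (vec_nth \<xi> i) * He n (vec_nth \<xi> j)"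
proof -
  have "He3 (axis i m + axis j n) \<xi>
      = (\<Prod>k\<in>UNIV. (if k = i then He m (vec_nth \<xi> i) else 1) * (if k = j then He n (vec_nth \<xi> j) else 1))"
    unfolding He3_def using assms by (intro prod.cong) (auto simp: axis_def)
  then show ?thesis
    by (simp add: prod.distrib)
qed

lemma He_2: "He 2 x = x\<^sup>2 - 1"
  by (simp add: numeral_2_eq_2)

text \<open>On the second coordinate axis the other two coordinates are 0, where \<open>He 2\<close>
  equals -1, so \<open>phi i\<close> reduces to an expression in one Hermite polynomial. The points
  are chosen by \<open>He_ge_1\<close>, except for \<open>i = 1\<close>, where the value at the unit
  vector is 1.\<close>

lemma phi_nonzero:
  assumes "i \<ge> 1"
  shows "\<exists>\<xi>. phi i \<xi> \<noteq> 0"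
proof -
  \<comment> \<open>The index type \<open>3\<close> computes modulo 3, so the numeral 3 denotes its
    zero; the three indices are still distinct.\<close>
  have ne: "(1::3) \<noteq> 2" "(3::3) \<noteq> 2" "(1::3) \<noteq> 3"
    by simp_all
  consider "i = 1" | "i \<noteq> 1" "even i" | "i \<noteq> 1" "odd i"
    by blast
  then show ?thesis
  proof cases
    case 1
    then have "phi i (axis 2 1) = 1"
      using ne by (simp add: phi_def He3_axis He_2 vec_nth_axis)
    then show ?thesis
      by (intro exI[of _ "axis 2 1"]) simp
  next
    case 2
    define n where "n = 2 * (i div 2) + 2"
    have "phi i (axis 2 (real n)) = He n (real n)"
      using 2 unfolding phi_def n_def by (simp only: Let_def He3_axis vec_nth_axis if_True if_False simp_thms)
    moreover have "He n (real n) \<ge> 1"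
      by (rule He_ge_1) simp
    ultimately show ?thesis
      by (intro exI[of _ "axis 2 (real n)"]) simp
  next
    case 3
    define n where "n = 2 * (i div 2)"
    let ?x = "axis 2 (real n) :: real ^ 3"
    have "phi i ?x = - He n (real n)"
      using 3 ne by (simp add: phi_def n_def[symmetric] He3_axis_add He_2 vec_nth_axis)
    moreover have "He n (real n) \<ge> 1"
      by (rule He_ge_1) simp
    ultimately show ?thesis
      by (intro exI[of _ ?x]) simp
  qed
qed

text \<open>This makes \<open>L1\<close> invertible. The squared norm integrates a continuous
  nonnegative function that is nonzero at the point from \<open>phi_nonzero\<close>.\<close>

lemma acoef_pos:
  assumes "i \<ge> 1"
  shows "acoef i > 0"
proof -
  obtain \<zeta> where \<zeta>: "phi i \<zeta> \<noteq> 0"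
    using phi_nonzero[OF assms] by blast
  have "poly_growth (\<lambda>\<xi>. phi i \<xi> * phi i \<xi> * (2 * pi) powr (- 3 / 2))"
    by (intro poly_growth_mult poly_growth_phi poly_growth_const)
  from integrable_poly_growth[OF this]
  have int: "integrable lborel (\<lambda>\<xi>. phi i \<xi> * phi i \<xi> * maxwellian \<xi>)"
    by (simp add: maxwellian_def mult.assoc)
  have "continuous_on UNIV (phi i)"
    using poly_growth_phi[of i] by (simp add: poly_growth_def)
  then have cont: "continuous_on UNIV (\<lambda>\<xi>. phi i \<xi> * phi i \<xi> * maxwellian \<xi>)"
    unfolding maxwellian_def by (intro continuous_intros) auto
  have "ip (phi i) (phi i) > 0"
    unfolding ip_def
    by (rule integral_pos_if_continuous[OF cont int, of \<zeta>]) (use \<zeta> in \<open>auto simp: maxwellian_def\<close>)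
  then show ?thesis
    by (simp add: acoef_def)
qed

section \<open>The Gram form on the negative half-line\<close>

text \<open>Extends \<open>S\<close> from Hermite polynomials to arbitrary functions, so that linear
  combinations and projections can be inserted. The factor \<open>x\<close> is nonpositive on the
  half-line, which gives the form its sign.\<close>

definition half_form :: "(real \<Rightarrow> real) \<Rightarrow> (real \<Rightarrow> real) \<Rightarrow> real" where
  "half_form f g = (LINT x:{..0}|lborel. x * f x * g x * exp (- x\<^sup>2 / 2))"

lemma integrable_half_form:
  assumes "poly_growth f" "poly_growth g"
  shows "set_integrable lborel {..0} (\<lambda>x. x * f x * g x * exp (- x\<^sup>2 / 2))"
proof -
  have "integrable lborel (\<lambda>x::real. x * f x * g x * exp (- (norm x)\<^sup>2 / 2))"
    by (intro integrable_poly_growth poly_growth_mult poly_growth_id assms)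
  then show ?thesis
    unfolding set_integrable_def by (intro integrable_mult_indicator) auto
qed

lemma half_form_sym: "half_form f g = half_form g f"
  unfolding half_form_def by (simp add: mult_ac)

lemma half_form_diff_left:
  assumes "poly_growth f" "poly_growth f'" "poly_growth g"
  shows "half_form (\<lambda>x. f x - f' x) g = half_form f g - half_form f' g"
  unfolding half_form_def
  using set_integral_diff(2)[OF integrable_half_form[OF assms(1,3)] integrable_half_form[OF assms(2,3)]]
  by (simp add: algebra_simps)

lemma half_form_scale_left: "half_form (\<lambda>x. c * f x) g = c * half_form f g"
  unfolding half_form_def
  by (subst set_integral_mult_right[symmetric]) (simp add: mult_ac)

lemma half_form_sum_left:
  assumes "finite I" "\<And>i. i \<in> I \<Longrightarrow> poly_growth (f i)" "poly_growth g"
  shows "half_form (\<lambda>x. \<Sum>i\<in>I. f i x) g = (\<Sum>i\<in>I. half_form (f i) g)"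
proof -
  have "half_form (\<lambda>x. \<Sum>i\<in>I. f i x) g
      = (LINT x:{..0}|lborel. (\<Sum>i\<in>I. x * f i x * g x * exp (- x\<^sup>2 / 2)))"
    unfolding half_form_def by (simp add: sum_distrib_left sum_distrib_right)
  also have "\<dots> = (\<Sum>i\<in>I. half_form (f i) g)"
    unfolding half_form_def set_lebesgue_integral_def scaleR_sum_right
    using assms integrable_half_form
    by (intro Bochner_Integration.integral_sum) (simp add: set_integrable_def)
  finally show ?thesis .
qed

lemma half_form_nonpos: "half_form f f \<le> 0"
proof -
  have "0 \<le> (LINT x:{..0}|lborel. - (x * f x * f x * exp (- x\<^sup>2 / 2)))"
    unfolding set_lebesgue_integral_def
  proof (intro integral_nonneg_AE AE_I2)
    fix x :: real
    have "0 \<le> (- x) * (f x)\<^sup>2 * exp (- x\<^sup>2 / 2)" if "x \<le> 0"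
      using that by (intro mult_nonneg_nonneg) auto
    then show "0 \<le> indicator {..0} x *\<^sub>R - (x * f x * f x * exp (- x\<^sup>2 / 2))"
      by (auto simp: indicator_def power2_eq_square mult.assoc)
  qed
  then show ?thesis
    by (simp add: half_form_def set_lebesgue_integral_def)
qed

text \<open>By bilinearity the quadratic form of a Gram matrix is the form at a single linear
  combination; \<open>half_form_nonpos\<close> thereby carries over to Gram matrices.\<close>

lemma half_form_double_sum:
  assumes "finite I" "\<And>i. i \<in> I \<Longrightarrow> poly_growth (f i)"
  shows "(\<Sum>i\<in>I. \<Sum>j\<in>I. c i * c j * half_form (f i) (f j))
    = half_form (\<lambda>x. \<Sum>i\<in>I. c i * f i x) (\<lambda>x. \<Sum>i\<in>I. c i * f i x)"
proof -
  let ?u = "\<lambda>x. \<Sum>i\<in>I. c i * f i x"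
  have pg: "poly_growth (\<lambda>x. c i * f i x)" if "i \<in> I" for i
    using that assms by (intro poly_growth_mult poly_growth_const)
  then have u: "poly_growth ?u"
    by (rule poly_growth_sum)
  have "half_form ?u ?u = (\<Sum>i\<in>I. c i * half_form (f i) ?u)"
    using half_form_sum_left[OF assms(1) pg u] by (simp add: half_form_scale_left)
  also have "half_form (f i) ?u = (\<Sum>j\<in>I. c j * half_form (f i) (f j))" if "i \<in> I" for i
    using half_form_sum_left[OF assms(1) pg assms(2)[OF that]]
    by (simp add: half_form_scale_left half_form_sym[of "f i"])
  then have "(\<Sum>i\<in>I. c i * half_form (f i) ?u) = (\<Sum>i\<in>I. \<Sum>j\<in>I. c i * c j * half_form (f i) (f j))"
    by (intro sum.cong) (simp_all add: sum_distrib_left mult.assoc)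
  finally show ?thesis ..
qed

section \<open>The entries of \<open>Tb\<close> as Gram matrices\<close>

lemma S_eq_half_form: "S a b = half_form (He a) (He b)"
  by (simp add: S_def half_form_def)

text \<open>Strictness is essential: \<open>tb\<close> divides by \<open>S 0 0\<close>, and its sign
  gives definiteness along the first axis. If the integral were 0, the integrand would vanish almost
  everywhere; on the half-line it vanishes only at 0, so the closed set \<open>{0..}\<close> would
  have full measure.\<close>

lemma S_0_0_neg: "S 0 0 < 0"
proof (rule ccontr)
  assume "\<not> ?thesis"
  then have S0: "S 0 0 = 0"
    using half_form_nonpos[of "He 0"] by (simp add: S_eq_half_form)
  let ?f = "\<lambda>x::real. indicator {..0} x *\<^sub>R (x * exp (- x\<^sup>2 / 2))"
  have int: "integrable lborel ?f"
    using integrable_half_form[OF poly_growth_const[of 1] poly_growth_const[of 1]]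
    by (simp add: set_integrable_def)
  have "(LINT x|lborel. - ?f x) = 0"
    using S0 by (simp add: S_def set_lebesgue_integral_def)
  then have "AE x in lborel. - ?f x = 0"
    by (subst (asm) integral_nonneg_eq_0_iff_AE)
      (use int in \<open>auto simp: indicator_def mult_le_0_iff intro!: AE_I2 integrable_minus\<close>)
  then have "AE x in lborel. x \<in> {0::real..}"
    by eventually_elim (auto simp: indicator_def split: if_splits)
  then have "- 1 \<in> {0::real..}"
    by (rule closed_AE_lborel_mem[rotated]) simp
  then show False
    by simp
qed

lemma poly_growth_He_self: "poly_growth (He n)"
  using poly_growth_He[OF poly_growth_id] .

text \<open>Being zero at indices of the other parity, these functions make each parity block of
  \<open>tb\<close> a Gram matrix over the full index range.\<close>

definition even_part :: "nat \<Rightarrow> real \<Rightarrow> real" where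
  "even_part i x = (if even i then He (i - 2) x else 0)"

text \<open>Subtracting the projection onto \<open>He 0\<close> turns the Schur complement in \<open>tb\<close> into a Gram matrix.\<close>

definition odd_part :: "nat \<Rightarrow> real \<Rightarrow> real" where
  "odd_part i x = (if odd i then He (i + 1) x - S (i + 1) 0 / S 0 0 else 0)"

lemma poly_growth_parts: "poly_growth (even_part i)" "poly_growth (odd_part i)"
  unfolding even_part_def[abs_def] odd_part_def[abs_def]
  by (cases "even i"; simp add: poly_growth_const poly_growth_He_self poly_growth_diff)+

lemma half_form_zero: "half_form (\<lambda>x. 0) g = 0" "half_form g (\<lambda>x. 0) = 0"
  by (simp_all add: half_form_def set_lebesgue_integral_def)

text \<open>Subtracting \<open>S n 0 / S 0 0\<close> makes \<open>He n\<close> orthogonal to the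
  constants for \<open>half_form\<close>. Pairing two such remainders gives the Schur complement of
  the entry \<open>S 0 0\<close>.\<close>

lemma half_form_schur:
  "half_form (\<lambda>x. He a x - S a 0 / S 0 0) (\<lambda>x. He b x - S b 0 / S 0 0)
    = S a b - S a 0 / S 0 0 * S 0 b"
proof -
  let ?g = "\<lambda>x. He b x - S b 0 / S 0 0"
  note pg = poly_growth_He_self poly_growth_const
  have g: "half_form (He n) ?g = S n b - S b 0 / S 0 0 * S n 0" for n
    unfolding half_form_sym[of "He n"]
    using half_form_diff_left[OF pg pg(1), of b "S b 0 / S 0 0" n]
      half_form_scale_left[of "S b 0 / S 0 0" "He 0" "He n"]
    by (simp add: S_eq_half_form half_form_sym[of "He n"])
  have "half_form (\<lambda>x. He a x - S a 0 / S 0 0) ?g = half_form (He a) ?g - S a 0 / S 0 0 * half_form (He 0) ?g"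
    using half_form_diff_left[OF pg(1) pg(2) poly_growth_diff[OF pg(1) pg(2)], of a "S a 0 / S 0 0" b "S b 0 / S 0 0"]
      half_form_scale_left[of "S a 0 / S 0 0" "He 0" ?g] by simp
  also have "\<dots> = S a b - S a 0 / S 0 0 * S 0 b"
    unfolding g using S_0_0_neg by (simp add: field_simps)
  finally show ?thesis .
qed

lemma tb_eq_half_form:
  "tb i j = half_form (even_part i) (even_part j) + half_form (odd_part i) (odd_part j)"
  by (auto simp: tb_def even_part_def[abs_def] odd_part_def[abs_def] half_form_zero S_eq_half_form
     half_form_schur[unfolded S_eq_half_form])

text \<open>The map \<open>k\<close> absorbs the shift from 0-based matrix positions to the 1-based
  indices of \<open>tb\<close>; a one-element family gives the sign of a diagonal entry.\<close>

lemma tb_nonpos: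
  assumes "finite I"
  shows "(\<Sum>i\<in>I. \<Sum>j\<in>I. c i * c j * tb (k i) (k j)) \<le> 0"
  unfolding tb_eq_half_form distrib_left sum.distrib
  using half_form_double_sum[OF assms, of "\<lambda>i. even_part (k i)" c]
    half_form_double_sum[OF assms, of "\<lambda>i. odd_part (k i)" c]
    half_form_nonpos
  by (simp add: poly_growth_parts add_nonpos_nonpos)

section \<open>Matrices and quadratic forms\<close>

lemma ex1_solution_if_trivial_kernel:
  fixes A :: "'a::field mat"
  assumes A: "A \<in> carrier_mat n n" and r: "r \<in> carrier_vec n"
    and ker: "\<And>z. z \<in> carrier_vec n \<Longrightarrow> A *\<^sub>v z = 0\<^sub>v n \<Longrightarrow> z = 0\<^sub>v n"
  shows "\<exists>!z. z \<in> carrier_vec n \<and> A *\<^sub>v z = r"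
proof -
  have "Determinant.det A \<noteq> 0"
    using det_0_iff_vec_prod_zero[OF A] ker by blast
  from det_non_zero_imp_unit[OF A this, of "()"]
  obtain B where B: "B \<in> carrier_mat n n" "B * A = 1\<^sub>m n" "A * B = 1\<^sub>m n"
    unfolding Units_def ring_mat_def by auto
  show ?thesis
  proof (rule ex1I[of _ "B *\<^sub>v r"])
    show "B *\<^sub>v r \<in> carrier_vec n \<and> A *\<^sub>v (B *\<^sub>v r) = r"
      using A B r by (simp flip: assoc_mult_mat_vec)
  next
    fix z
    assume z: "z \<in> carrier_vec n \<and> A *\<^sub>v z = r"
    then have "B *\<^sub>v r = (B * A) *\<^sub>v z"
      using assoc_mult_mat_vec[OF B(1) A] by metis
    then show "z = B *\<^sub>v r"
      using z B by simp
  qed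
qed

text \<open>The result of \<open>mat_inverse\<close> is known only as some inverse; uniqueness of
  inverses identifies it with the explicit diagonal matrix.\<close>

lemma mat_inverse_if_diag_nonzero:
  fixes f :: "nat \<Rightarrow> 'a::field"
  assumes "\<And>i. i < n \<Longrightarrow> f i \<noteq> 0"
  shows "the (mat_inverse (mat_diag n f)) = mat_diag n (\<lambda>i. 1 / f i)"
proof -
  let ?A = "mat_diag n f" and ?B = "mat_diag n (\<lambda>i. 1 / f i)"
  have inv: "?A * ?B = 1\<^sub>m n" "?B * ?A = 1\<^sub>m n"
    using assms unfolding mat_diag_diag by (auto simp: mat_diag_def intro!: eq_matI)
  then have "?A \<in> Units (ring_mat TYPE('a) n ())"
    unfolding Units_def ring_mat_def by (auto intro!: bexI[of _ ?B])
  then obtain B where B: "mat_inverse ?A = Some B"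
    using mat_inverse(1)[where A = ?A and n = n and b = "()"] by (cases "mat_inverse ?A") auto
  then have B': "B * ?A = 1\<^sub>m n" "B \<in> carrier_mat n n"
    using mat_inverse(2)[where A = ?A and n = n and B = B] by simp_all
  have "B = B * (?A * ?B)"
    using inv B' by simp
  also have "\<dots> = (B * ?A) * ?B"
    by (rule assoc_mult_mat[symmetric, OF B'(2) mat_diag_dim mat_diag_dim])
  also have "\<dots> = ?B"
    using B' by (simp add: left_mult_one_mat[OF mat_diag_dim])
  finally show ?thesis
    using B by simp
qed

lemma diag_block_mat_pair:
  "diag_block_mat [A, B] = four_block_mat A (0\<^sub>m (dim_row A) (dim_col B)) (0\<^sub>m (dim_row B) (dim_col A)) B"
  by (simp only: diag_block_mat.simps(2)[of A "[B]"] diag_block_mat_singleton Let_def)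

text \<open>The unknown consists of one scalar followed by a vector; this rule evaluates the
  block-diagonal matrices of the system on such a pair.\<close>

lemma diag_block_mat_pair_mult_vCons:
  assumes "A \<in> carrier_mat 1 1" "B \<in> carrier_mat nr nc" "v \<in> carrier_vec nc"
  shows "diag_block_mat [A, B] *\<^sub>v vCons t v = vCons (A $$ (0, 0) * t) (B *\<^sub>v v)"
proof -
  have eq: "vCons s w = vCons s vNil @\<^sub>v w" for s and w :: "'a Matrix.vec"
    by simp
  have "diag_block_mat [A, B] *\<^sub>v (vCons t vNil @\<^sub>v v)
      = (A *\<^sub>v vCons t vNil + 0\<^sub>m 1 nc *\<^sub>v v) @\<^sub>v (0\<^sub>m nr 1 *\<^sub>v vCons t vNil + B *\<^sub>v v)"
    unfolding diag_block_mat_pair using assms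
    by (subst four_block_mat_mult_vec[of A 1 1 _ nc _ nr]) auto
  also have "0\<^sub>m nr 1 *\<^sub>v vCons t vNil + B *\<^sub>v v = B *\<^sub>v v"
    using assms by (intro eq_vecI) (auto simp: scalar_prod_def)
  also have "A *\<^sub>v vCons t vNil + 0\<^sub>m 1 nc *\<^sub>v v = vCons (A $$ (0, 0) * t) vNil"
    using assms by (intro eq_vecI) (auto simp: scalar_prod_def)
  finally show ?thesis
    by simp
qed

section \<open>Block identities from the orthogonal diagonalization\<close>

lemma four_block_mat_eqD:
  assumes "four_block_mat A B C D = four_block_mat A' B' C' D'"
    and "A \<in> carrier_mat nr nc" "A' \<in> carrier_mat nr nc" "B \<in> carrier_mat nr nc'" "B' \<in> carrier_mat nr nc'"
      "D \<in> carrier_mat nr' nc'" "D' \<in> carrier_mat nr' nc'"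
  shows "A = A'" "B = B'"
proof -
  have eq: "four_block_mat A B C D $$ (i, j) = four_block_mat A' B' C' D' $$ (i, j)" for i j
    by (simp add: assms(1))
  show "A = A'"
  proof (rule eq_matI)
    fix i j
    assume "i < dim_row A'" "j < dim_col A'"
    then show "A $$ (i, j) = A' $$ (i, j)"
      using eq[of i j] assms(2-) by simp
  qed (use assms in auto)
  show "B = B'"
  proof (rule eq_matI)
    fix i j
    assume "i < dim_row B'" "j < dim_col B'"
    then show "B $$ (i, j) = B' $$ (i, j)"
      using eq[of i "nc + j"] assms(2-) by simp
  qed (use assms in auto)
qed

text \<open>For odd \<open>M\<close> both \<open>R0\<close> and the zero block of
  \<open>E_mat\<close> have no columns.\<close>

lemma hcat_zero_cols:
  assumes "A \<in> carrier_mat nr nc" "B \<in> carrier_mat nr 0"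
  shows "hcat A B = A"
  using assms by (intro eq_matI) (auto simp: hcat_def)

text \<open>The first block row of \<open>R\<^sup>T R = 1\<close> says that the Gram matrices of
  \<open>Reven\<close> and \<open>Rodd\<close> have sum 1 and difference 0, so each is one half of
  the identity. The upper left block of \<open>MM R = R \<Lambda>\<close> is
  \<open>M0 Rodd = Reven Lp\<close>.\<close>

lemma is_diagonalizationD:
  assumes diag: "is_diagonalization M Reven Rodd R0 Lp"
    and eq: "m_even M = n" "m_odd M = n"
  shows "Reven \<in> carrier_mat n n" "Rodd \<in> carrier_mat n n" "Lp \<in> carrier_mat n n"
    and "diagonal_mat Lp" "\<And>i. i < n \<Longrightarrow> 0 < Lp $$ (i, i)"
    and "transpose_mat Reven * Reven = (1 / 2) \<cdot>\<^sub>m 1\<^sub>m n"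
    and "M0 M * Rodd = Reven * Lp"
proof -
  show Re: "Reven \<in> carrier_mat n n" and Ro: "Rodd \<in> carrier_mat n n" and L: "Lp \<in> carrier_mat n n"
    and "diagonal_mat Lp" "\<And>i. i < n \<Longrightarrow> 0 < Lp $$ (i, i)"
    using diag unfolding is_diagonalization_def eq by auto
  have R0: "R0 \<in> carrier_mat n 0"
    using diag unfolding is_diagonalization_def eq by auto
  have M: "M0 M \<in> carrier_mat n n"
    by (simp add: M0_def eq)
  have "hcat Reven R0 = Reven" "hcat Rodd (0\<^sub>m n 0) = Rodd"
    using hcat_zero_cols Re Ro R0 by auto
  then have R: "R_mat M Reven Rodd R0 = four_block_mat Reven Reven Rodd (- Rodd)"
    by (simp add: R_mat_def eq)
  have Lam: "Lambda_mat M Lp = four_block_mat Lp (0\<^sub>m n n) (0\<^sub>m n n) (- Lp)"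
  proof -
    \<comment> \<open>The middle diagonal block of \<open>Lambda_mat\<close> has size 0 and
      disappears.\<close>
    have "diag_block_mat [0\<^sub>m 0 0, - Lp] = - Lp"
      using L by (intro eq_matI) (auto simp: diag_block_mat_pair)
    then show ?thesis
      using L by (simp add: Lambda_mat_def eq Let_def)
  qed
  have one: "1\<^sub>m (n + n) = four_block_mat (1\<^sub>m n) (0\<^sub>m n n) (0\<^sub>m n n) (1\<^sub>m n :: real mat)"
    by (intro eq_matI) auto
  have MMR: "MM M * R_mat M Reven Rodd R0 = R_mat M Reven Rodd R0 * Lambda_mat M Lp"
    and orth: "transpose_mat (R_mat M Reven Rodd R0) * R_mat M Reven Rodd R0 = 1\<^sub>m (n + n)"
    using diag unfolding is_diagonalization_def eq Let_def by auto
  let ?Te = "transpose_mat Reven" and ?To = "transpose_mat Rodd"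
  have "four_block_mat (?Te * Reven + ?To * Rodd) (?Te * Reven + ?To * (- Rodd))
      (?Te * Reven + (transpose_mat (- Rodd)) * Rodd) (?Te * Reven + (transpose_mat (- Rodd)) * (- Rodd))
      = four_block_mat (1\<^sub>m n) (0\<^sub>m n n) (0\<^sub>m n n) (1\<^sub>m n)"
    using orth unfolding R one
    using Re Ro by (simp add: transpose_four_block_mat[of _ n n _ n _ n] mult_four_block_mat[of _ n n _ n _ n _ _ n _ n])
  from four_block_mat_eqD[OF this, of n n n n] Re Ro
  have "?Te * Reven + ?To * Rodd = 1\<^sub>m n" "?Te * Reven + ?To * (- Rodd) = 0\<^sub>m n n"
    by simp_all
  then have sum: "(?Te * Reven) $$ (i, j) + (?To * Rodd) $$ (i, j) = (1\<^sub>m n) $$ (i, j)"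
    "(?Te * Reven) $$ (i, j) - (?To * Rodd) $$ (i, j) = 0" if "i < n" "j < n" for i j
    using that Re Ro by (auto simp: mat_eq_iff simp del: index_mult_mat(1))
  show "?Te * Reven = (1 / 2) \<cdot>\<^sub>m 1\<^sub>m n"
  proof (rule eq_matI)
    fix i j
    assume "i < dim_row ((1 / 2) \<cdot>\<^sub>m 1\<^sub>m n :: real mat)" "j < dim_col ((1 / 2) \<cdot>\<^sub>m 1\<^sub>m n :: real mat)"
    then have "i < n" "j < n"
      by auto
    with sum[of i j] show "(?Te * Reven) $$ (i, j) = ((1 / 2) \<cdot>\<^sub>m 1\<^sub>m n) $$ (i, j)"
      by (simp del: index_mult_mat(1))
  qed (use Re in auto)
  have "- 0\<^sub>m n n = (0\<^sub>m n n :: real mat)"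
    by (intro eq_matI) auto
  then have "four_block_mat (M0 M * Rodd) (M0 M * (- Rodd))
      (transpose_mat (M0 M) * Reven) (transpose_mat (M0 M) * Reven)
      = four_block_mat (Reven * Lp) (Reven * (- Lp)) (Rodd * Lp) ((- Rodd) * (- Lp))"
    using MMR unfolding R Lam MM_def eq
    using Re Ro M L by (simp add: mult_four_block_mat[of _ n n _ n _ n _ _ n _ n])
  from four_block_mat_eqD(1)[OF this, of n n n n] Re Ro M L
  show "M0 M * Rodd = Reven * Lp"
    by simp
qed

lemma diagonal_quadratic_form:
  fixes L :: "'a::comm_semiring_0 mat"
  assumes "L \<in> carrier_mat n n" "diagonal_mat L" "v \<in> carrier_vec n"
  shows "v \<bullet> (L *\<^sub>v v) = (\<Sum>i<n. L $$ (i, i) * (v $ i * v $ i))"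
proof -
  have "(L *\<^sub>v v) $ i = L $$ (i, i) * v $ i" if "i < n" for i
  proof -
    have "(L *\<^sub>v v) $ i = (\<Sum>j\<in>{0..<n}. L $$ (i, j) * v $ j)"
      using assms that by (simp add: scalar_prod_def)
    also have "\<dots> = (\<Sum>j\<in>{0..<n}. if j = i then L $$ (i, i) * v $ i else 0)"
      using assms that by (intro sum.cong) (auto simp: diagonal_mat_def)
    finally show ?thesis
      using that by simp
  qed
  then show ?thesis
    using assms by (auto simp: scalar_prod_def mult_ac lessThan_atLeast0 intro!: sum.cong)
qed

lemma quadratic_form_congruence:
  fixes Q B :: "'a::comm_semiring_1 mat"
  assumes "Q \<in> carrier_mat n n" "B \<in> carrier_mat n n" "y \<in> carrier_vec n"
  shows "y \<bullet> ((transpose_mat Q * B * Q) *\<^sub>v y) = (Q *\<^sub>v y) \<bullet> (B *\<^sub>v (Q *\<^sub>v y))"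
proof -
  have "y \<bullet> ((transpose_mat Q * B * Q) *\<^sub>v y) = y \<bullet> (transpose_mat Q *\<^sub>v (B *\<^sub>v (Q *\<^sub>v y)))"
    using assms by (simp add: assoc_mult_mat_vec[of _ n n _ n])
  also have "\<dots> = (Q *\<^sub>v y) \<bullet> (B *\<^sub>v (Q *\<^sub>v y))"
    using transpose_vec_mult_scalar[of "transpose_mat Q" n n "B *\<^sub>v (Q *\<^sub>v y)" y] assms by simp
  finally show ?thesis .
qed

section \<open>Sign of the quadratic forms of \<open>Tb\<close> and \<open>T_mat\<close>\<close>

lemma Tb_quadratic_form:
  assumes "x \<in> carrier_vec (m_even M + 1)"
  shows "x \<bullet> (Tb M *\<^sub>v x)
    = (\<Sum>i<m_even M + 1. \<Sum>j<m_even M + 1. x $ i * x $ j * tb (i + 1) (j + 1))"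
proof -
  have "(Tb M *\<^sub>v x) $ i = (\<Sum>j<m_even M + 1. x $ j * tb (i + 1) (j + 1))" if "i < m_even M + 1" for i
    using assms that by (simp add: scalar_prod_def Tb_def mult.commute lessThan_atLeast0 del: sum.op_ivl_Suc)
  then show ?thesis
    using assms
    by (simp add: scalar_prod_def Tb_def sum_distrib_left mult.assoc lessThan_atLeast0 del: sum.op_ivl_Suc)
qed

lemma quadratic_form_Tb_nonpos:
  assumes "x \<in> carrier_vec (m_even M + 1)"
  shows "x \<bullet> (Tb M *\<^sub>v x) \<le> 0"
  unfolding Tb_quadratic_form[OF assms]
  using tb_nonpos[where I = "{..<m_even M + 1}" and c = "\<lambda>i. x $ i" and k = "\<lambda>i. i + 1"] by simp

definition L1_inv :: "nat \<Rightarrow> real mat" where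
  "L1_inv M = mat_diag (m_even M) (\<lambda>i. 1 / acoef (i + 1))"

lemma mat_inverse_L1: "the (mat_inverse (L1 M)) = L1_inv M"
proof -
  have "acoef (i + 1) \<noteq> 0" for i
    using acoef_pos[of "i + 1"] by simp
  then show ?thesis
    unfolding L1_def L1_inv_def by (intro mat_inverse_if_diag_nonzero)
qed

lemma transpose_diag_block_mat_pair:
  "transpose_mat (diag_block_mat [A, B]) = diag_block_mat [transpose_mat A, transpose_mat B]"
  unfolding diag_block_mat_pair by (intro eq_matI) auto

lemma transpose_mat_diag: "transpose_mat (mat_diag n f) = mat_diag n f"
  by (intro eq_matI) (auto simp: mat_diag_def)

text \<open>The factor to the right of \<open>Tb\<close> in \<open>T_mat\<close>. The one to the
  left is its transpose because both block-diagonal matrices are symmetric, so \<open>T_mat\<close>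
  is congruent to \<open>Tb\<close>.\<close>

definition T_factor :: "nat \<Rightarrow> real mat" where
  "T_factor M = diag_block_mat [P1, 1\<^sub>m (m_even M - 1)] * diag_block_mat [1\<^sub>m 1, L1_inv M]"

lemma P1_carrier: "P1 \<in> carrier_mat 2 2"
  unfolding P1_def mat_of_rows_list_def by (intro carrier_matI) auto

lemma P1_index: "P1 $$ (0, 0) = 1 / 2" "P1 $$ (0, Suc 0) = 1" "P1 $$ (Suc 0, 0) = 1" "P1 $$ (Suc 0, Suc 0) = - 1"
  by (simp_all add: P1_def mat_of_rows_list_def)

lemma transpose_P1: "transpose_mat P1 = P1"
  using P1_carrier by (intro eq_matI) (auto simp: P1_index less_2_cases_iff)

context
  fixes M :: nat
  assumes M: "M \<ge> 2"
begin

text \<open>Ensures that the block sizes 2 and \<open>m_even M - 1\<close> add up to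
  \<open>m_even M + 1\<close> despite truncated subtraction.\<close>

lemma m_even_pos: "m_even M \<ge> 1"
proof -
  have "M div 2 \<ge> 1"
    using M by simp
  then show ?thesis
    unfolding m_even_def by linarith
qed

lemma T_factor_parts_carrier:
  "diag_block_mat [P1, 1\<^sub>m (m_even M - 1)] \<in> carrier_mat (m_even M + 1) (m_even M + 1)"
  "diag_block_mat [1\<^sub>m 1, L1_inv M] \<in> carrier_mat (m_even M + 1) (m_even M + 1)"
  using m_even_pos P1_carrier by (auto simp: diag_block_mat_pair L1_inv_def mat_diag_def)

lemma T_factor_carrier: "T_factor M \<in> carrier_mat (m_even M + 1) (m_even M + 1)"
  unfolding T_factor_def using T_factor_parts_carrier by (rule mult_carrier_mat)

lemma Tb_carrier: "Tb M \<in> carrier_mat (m_even M + 1) (m_even M + 1)"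
  by (simp add: Tb_def)

lemma T_mat_eq: "T_mat M = transpose_mat (T_factor M) * Tb M * T_factor M"
proof -
  let ?D = "diag_block_mat [1\<^sub>m 1, L1_inv M]" and ?P = "diag_block_mat [P1, 1\<^sub>m (m_even M - 1)]"
  let ?n = "m_even M + 1"
  note c = T_factor_parts_carrier Tb_carrier
  have "transpose_mat (T_factor M) = ?D * ?P"
    unfolding T_factor_def using c
    by (subst transpose_mult[of _ ?n ?n _ ?n])
      (simp_all add: transpose_diag_block_mat_pair transpose_P1 L1_inv_def transpose_mat_diag
        del: diag_block_mat.simps)
  moreover have "?D * ?P * Tb M * ?P * ?D = ?D * ?P * Tb M * (?P * ?D)"
    using c by (intro assoc_mult_mat[of _ ?n ?n _ ?n _ ?n]) auto
  ultimately show ?thesis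
    by (simp add: T_mat_def Let_def mat_inverse_L1 T_factor_def)
qed

lemma T_mat_carrier: "T_mat M \<in> carrier_mat (m_even M + 1) (m_even M + 1)"
  unfolding T_mat_eq using T_factor_carrier Tb_carrier by auto

lemma quadratic_form_T_mat:
  assumes "y \<in> carrier_vec (m_even M + 1)"
  shows "y \<bullet> (T_mat M *\<^sub>v y) = (T_factor M *\<^sub>v y) \<bullet> (Tb M *\<^sub>v (T_factor M *\<^sub>v y))"
  unfolding T_mat_eq using quadratic_form_congruence[OF T_factor_carrier Tb_carrier assms] .

lemma quadratic_form_T_mat_nonpos:
  assumes "y \<in> carrier_vec (m_even M + 1)"
  shows "y \<bullet> (T_mat M *\<^sub>v y) \<le> 0"
  unfolding quadratic_form_T_mat[OF assms]
  using assms T_factor_carrier by (intro quadratic_form_Tb_nonpos) auto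

text \<open>The normalizing matrix fixes the first axis, so only the first column
  \<open>(1/2, 1)\<close> of \<open>P1\<close> contributes.\<close>

lemma T_factor_mult_first_axis:
  "T_factor M *\<^sub>v vCons t (0\<^sub>v (m_even M)) = vCons (t / 2) (vCons t (0\<^sub>v (m_even M - 1)))"
proof -
  let ?D = "diag_block_mat [1\<^sub>m 1, L1_inv M]" and ?P = "diag_block_mat [P1, 1\<^sub>m (m_even M - 1)]"
  let ?n = "m_even M + 1"
  let ?y = "vCons t (0\<^sub>v (m_even M))"
  have y: "?y \<in> carrier_vec ?n"
    by simp
  have "L1_inv M *\<^sub>v 0\<^sub>v (m_even M) = 0\<^sub>v (m_even M)"
    by (intro eq_vecI) (auto simp: L1_inv_def mat_diag_def)
  then have "?D *\<^sub>v ?y = ?y"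
    by (subst diag_block_mat_pair_mult_vCons[of _ _ "m_even M" "m_even M"]) (auto simp: L1_inv_def)
  then have "T_factor M *\<^sub>v ?y = ?P *\<^sub>v ?y"
    unfolding T_factor_def using assoc_mult_mat_vec[OF T_factor_parts_carrier y] by simp
  also have "\<dots> = vCons (t / 2) (vCons t (0\<^sub>v (m_even M - 1)))"
  proof (rule eq_vecI)
    fix i
    assume "i < dim_vec (vCons (t / 2) (vCons t (0\<^sub>v (m_even M - 1))))"
    then have i: "i < ?n"
      using m_even_pos by simp
    have "(?P *\<^sub>v ?y) $ i = (\<Sum>j\<in>{0..<?n}. ?P $$ (i, j) * ?y $ j)"
      using i T_factor_parts_carrier(1) by (simp add: scalar_prod_def del: sum.op_ivl_Suc diag_block_mat.simps)
    also have "\<dots> = (\<Sum>j\<in>{0..<?n}. if j = 0 then ?P $$ (i, 0) * t else 0)"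
      by (intro sum.cong) (auto simp: vec_index_vCons)
    also have "\<dots> = ?P $$ (i, 0) * t"
      by (simp del: diag_block_mat.simps)
    also have "\<dots> = vCons (t / 2) (vCons t (0\<^sub>v (m_even M - 1))) $ i"
      using i m_even_pos P1_carrier P1_index
      by (cases "i = 0"; cases "i = Suc 0") (auto simp: diag_block_mat_pair vec_index_vCons)
    finally show "(?P *\<^sub>v ?y) $ i = vCons (t / 2) (vCons t (0\<^sub>v (m_even M - 1))) $ i" .
  qed (use T_factor_parts_carrier(1) m_even_pos P1_carrier in auto)
  finally show ?thesis .
qed

text \<open>Semidefiniteness alone cannot exclude a nonzero scalar unknown; this is the strict sign
  in that direction.\<close>

lemma quadratic_form_T_mat_first_axis:
  assumes "t \<noteq> 0"
  shows "vCons t (0\<^sub>v (m_even M)) \<bullet> (T_mat M *\<^sub>v vCons t (0\<^sub>v (m_even M))) < 0"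
proof -
  let ?x = "vCons (t / 2) (vCons t (0\<^sub>v (m_even M - 1)))"
  let ?n = "m_even M + 1"
  have x: "?x \<in> carrier_vec ?n"
    using m_even_pos by (auto intro!: carrier_vecI)
  have zero: "?x $ i = 0" if "i < ?n" "i \<ge> 2" for i
    using that by (auto simp: vec_index_vCons)
  have "vCons t (0\<^sub>v (m_even M)) \<bullet> (T_mat M *\<^sub>v vCons t (0\<^sub>v (m_even M))) = ?x \<bullet> (Tb M *\<^sub>v ?x)"
    by (subst quadratic_form_T_mat) (simp_all add: T_factor_mult_first_axis)
  also have "\<dots> = (\<Sum>i<?n. \<Sum>j<?n. ?x $ i * ?x $ j * tb (i + 1) (j + 1))"
    by (rule Tb_quadratic_form[OF x])
  also have "\<dots> = (\<Sum>i<2. \<Sum>j<?n. ?x $ i * ?x $ j * tb (i + 1) (j + 1))"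
    using m_even_pos zero by (intro sum.mono_neutral_right) auto
  also have "\<dots> = (\<Sum>i<2. \<Sum>j<2. ?x $ i * ?x $ j * tb (i + 1) (j + 1))"
    using m_even_pos zero by (intro sum.cong refl sum.mono_neutral_right) auto
  \<comment> \<open>The cross terms \<open>tb 1 2\<close> and \<open>tb 2 1\<close> vanish by
    parity, and \<open>tb 2 2\<close> is \<open>S 0 0\<close>.\<close>
  also have "\<dots> = t\<^sup>2 / 4 * tb 1 1 + t\<^sup>2 * S 0 0"
    by (simp add: numeral_2_eq_2 tb_def power2_eq_square)
  also have "\<dots> < 0"
  proof -
    have "tb 1 1 \<le> 0"
      using tb_nonpos[of "{0 :: nat}" "\<lambda>_. 1" "\<lambda>_. 1"] by simp
    then have "t\<^sup>2 / 4 * tb 1 1 \<le> 0"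
      by (simp add: mult_nonneg_nonpos)
    moreover have "t\<^sup>2 * S 0 0 < 0"
      using assms S_0_0_neg by (simp add: mult_pos_neg)
    ultimately show ?thesis
      by linarith
  qed
  finally show ?thesis .
qed

end

section \<open>Unique solvability of the linear system\<close>

lemma smult_mat_mult_vec:
  fixes A :: "'a::comm_semiring_0 mat"
  assumes "A \<in> carrier_mat nr nc" "v \<in> carrier_vec nc"
  shows "(c \<cdot>\<^sub>m A) *\<^sub>v v = c \<cdot>\<^sub>v (A *\<^sub>v v)"
  using assms by (intro eq_vecI) (auto simp: scalar_prod_def sum_distrib_left mult.assoc)

lemma vec_add_eq_iff:
  fixes r g a :: "'a::ab_group_add Matrix.vec"
  assumes "r \<in> carrier_vec n" "g \<in> carrier_vec n" "a \<in> carrier_vec n"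
  shows "r + g = a \<longleftrightarrow> a - g = r"
  using assms by (auto simp: vec_eq_iff algebra_simps)

lemma E_mat_eq_one:
  assumes "m_even M = m_odd M"
  shows "E_mat M = 1\<^sub>m (m_odd M + 1)"
  unfolding E_mat_def assms by (intro hcat_zero_cols[of _ "m_odd M + 1" "m_odd M + 1"]) auto

lemma system_matrix_trivial_kernel:
  assumes M: "M \<ge> 2" and eq: "m_even M = n" "m_odd M = n" and beta: "\<beta> > 0"
    and diag: "is_diagonalization M Reven Rodd R0 Lp" and v: "v \<in> carrier_vec n"
    and ker: "\<beta> \<cdot>\<^sub>v (T_mat M *\<^sub>v vCons t (Reven *\<^sub>v v)) = vCons 0 (M0 M *\<^sub>v (Rodd *\<^sub>v v))"
  shows "t = 0 \<and> v = 0\<^sub>v n"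
proof -
  note d = is_diagonalizationD[OF diag eq]
  have M0: "M0 M \<in> carrier_mat n n"
    by (simp add: M0_def eq)
  let ?y = "vCons t (Reven *\<^sub>v v)"
  have y: "?y \<in> carrier_vec (n + 1)"
    using d v by simp
  note T = T_mat_carrier[OF M, unfolded eq]
  have MR: "M0 M *\<^sub>v (Rodd *\<^sub>v v) = Reven *\<^sub>v (Lp *\<^sub>v v)"
    using assoc_mult_mat_vec[OF M0 d(2) v] assoc_mult_mat_vec[OF d(1,3) v] d(7) by simp
  \<comment> \<open>The right-hand vector has first entry 0, so \<open>t\<close> leaves its pairing
    with \<open>?y\<close> and only the \<open>Reven\<close> parts remain.\<close>
  have "\<beta> * (?y \<bullet> (T_mat M *\<^sub>v ?y)) = ?y \<bullet> vCons 0 (M0 M *\<^sub>v (Rodd *\<^sub>v v))"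
    using y T ker by (metis mult_mat_vec_carrier scalar_prod_smult_distrib)
  also have "\<dots> = (Reven *\<^sub>v v) \<bullet> (Reven *\<^sub>v (Lp *\<^sub>v v))"
    by (simp add: MR)
  also have "\<dots> = (transpose_mat Reven *\<^sub>v (Reven *\<^sub>v v)) \<bullet> (Lp *\<^sub>v v)"
    using d v by (subst transpose_vec_mult_scalar[of _ n n]) auto
  also have "transpose_mat Reven *\<^sub>v (Reven *\<^sub>v v) = (1 / 2) \<cdot>\<^sub>v v"
  proof -
    have "transpose_mat Reven *\<^sub>v (Reven *\<^sub>v v) = ((1 / 2) \<cdot>\<^sub>m 1\<^sub>m n) *\<^sub>v v"
      using assoc_mult_mat_vec[of "transpose_mat Reven" n n Reven n v] d v by simp
    also have "\<dots> = (1 / 2) \<cdot>\<^sub>v v"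
      using v by (simp add: smult_mat_mult_vec[of _ n n])
    finally show ?thesis .
  qed
  also have "\<dots> \<bullet> (Lp *\<^sub>v v) = 1 / 2 * (\<Sum>i<n. Lp $$ (i, i) * (v $ i * v $ i))"
    using d v diagonal_quadratic_form[OF d(3,4) v] by simp
  finally have form: "\<beta> * (?y \<bullet> (T_mat M *\<^sub>v ?y)) = 1 / 2 * (\<Sum>i<n. Lp $$ (i, i) * (v $ i * v $ i))" .
  have terms: "Lp $$ (i, i) * (v $ i * v $ i) \<ge> 0" if "i < n" for i
    using d(5)[OF that] by simp
  have "?y \<bullet> (T_mat M *\<^sub>v ?y) \<le> 0"
    using quadratic_form_T_mat_nonpos[OF M] y eq by simp
  then have "\<beta> * (?y \<bullet> (T_mat M *\<^sub>v ?y)) \<le> 0"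
    using beta by (simp add: mult_nonneg_nonpos)
  moreover have "(\<Sum>i<n. Lp $$ (i, i) * (v $ i * v $ i)) \<ge> 0"
    using terms by (intro sum_nonneg) auto
  ultimately have zero: "(\<Sum>i<n. Lp $$ (i, i) * (v $ i * v $ i)) = 0"
    using form by linarith
  \<comment> \<open>A vanishing sum of nonnegative terms has vanishing terms, and each eigenvalue
    \<open>Lp $$ (i, i)\<close> is positive.\<close>
  have "v $ i = 0" if "i < n" for i
  proof -
    have "Lp $$ (i, i) * (v $ i * v $ i) = 0"
      using that zero terms
        sum_nonneg_eq_0_iff[of "{..<n}" "\<lambda>i. Lp $$ (i, i) * (v $ i * v $ i)"] by simp
    with d(5)[OF that] show ?thesis
      by simp
  qed
  then have v0: "v = 0\<^sub>v n"
    using v by (intro eq_vecI) auto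
  moreover have "t = 0"
  proof (rule ccontr)
    assume "t \<noteq> 0"
    \<comment> \<open>With \<open>v = 0\<close> the vector \<open>?y\<close> lies on the first axis,
      where the form of \<open>T_mat\<close> is strictly negative although \<open>form\<close> makes
      it 0.\<close>
    have Rev0: "Reven *\<^sub>v 0\<^sub>v n = 0\<^sub>v n"
      using d(1) by (intro eq_vecI) auto
    from quadratic_form_T_mat_first_axis[OF M \<open>t \<noteq> 0\<close>] have "?y \<bullet> (T_mat M *\<^sub>v ?y) < 0"
      using Rev0 by (simp add: eq v0)
    with form zero beta show False
      by simp
  qed
  ultimately show ?thesis
    by simp
qed

theorem theorem3p3:
  fixes M :: nat and chi q2 \<theta>W :: real
    and Reven Rodd R0 Lp :: "real mat"
  assumes "M \<ge> 3" and "odd M"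
    and "0 < chi" and "chi \<le> 1"
    and "is_diagonalization M Reven Rodd R0 Lp"
  shows "\<exists>!(\<theta>, v). v \<in> carrier_vec (m_odd M) \<and>
    q2 \<cdot>\<^sub>v c_r M
      + E_mat M *\<^sub>v (diag_block_mat [0\<^sub>m 1 1, M0 M] *\<^sub>v vCons (\<theta> - \<theta>W) (Rodd *\<^sub>v v))
    = b_coef chi \<cdot>\<^sub>v (E_mat M *\<^sub>v (T_mat M *\<^sub>v vCons (\<theta> - \<theta>W) (Reven *\<^sub>v v)))"
proof -
  define n where "n = m_odd M"
  \<comment> \<open>For \<open>M = 2 * k + 1\<close> both sizes are \<open>2 * k - 1\<close>, which
    makes the system square.\<close>
  have eq: "m_even M = n" "m_odd M = n"
    using assms(2) by (auto simp: n_def m_even_def m_odd_def elim!: oddE)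
  have M: "M \<ge> 2"
    using assms(1) by simp
  \<comment> \<open>The bound \<open>chi \<le> 1\<close> keeps the denominator
    \<open>2 - chi\<close> positive.\<close>
  have b: "b_coef chi > 0"
    using assms(3,4) by (simp add: b_coef_def)
  note d = is_diagonalizationD[OF assms(5) eq]
  note T = T_mat_carrier[OF M, unfolded eq]
  have M0: "M0 M \<in> carrier_mat n n"
    by (simp add: M0_def eq)
  let ?A = "\<lambda>z. b_coef chi \<cdot>\<^sub>v (T_mat M *\<^sub>v z)"
  \<comment> \<open>\<open>K\<close> and \<open>G\<close> absorb \<open>Reven\<close> and
    \<open>Rodd\<close>, so that \<open>W\<close> is the square matrix of the system in the unknown
    \<open>vCons (\<theta> - \<theta>W) v\<close>, with right-hand side
    \<open>q2 \<cdot>\<^sub>v c_r M\<close>.\<close>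
  define K where "K = diag_block_mat [1\<^sub>m 1, Reven]"
  define G where "G = diag_block_mat [0\<^sub>m 1 1, M0 M * Rodd]"
  define W where "W = b_coef chi \<cdot>\<^sub>m (T_mat M * K) - G"
  have K: "K \<in> carrier_mat (n + 1) (n + 1)" and G: "G \<in> carrier_mat (n + 1) (n + 1)"
    using d(1,2) M0 by (auto simp: K_def G_def diag_block_mat_pair)
  then have W: "W \<in> carrier_mat (n + 1) (n + 1)"
    using T unfolding W_def by (intro minus_carrier_mat) auto
  have W_vCons: "W *\<^sub>v vCons t v
      = ?A (vCons t (Reven *\<^sub>v v)) - vCons 0 (M0 M *\<^sub>v (Rodd *\<^sub>v v))"
    if v: "v \<in> carrier_vec n" for t v
  proof -
    have z: "vCons t v \<in> carrier_vec (n + 1)"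
      using v by simp
    have "K *\<^sub>v vCons t v = vCons t (Reven *\<^sub>v v)"
      unfolding K_def using d(1) v by (subst diag_block_mat_pair_mult_vCons) auto
    moreover have "G *\<^sub>v vCons t v = vCons 0 (M0 M *\<^sub>v (Rodd *\<^sub>v v))"
      unfolding G_def using d(2) M0 v by (subst diag_block_mat_pair_mult_vCons[of _ _ n n]) auto
    moreover have "W *\<^sub>v vCons t v = (b_coef chi \<cdot>\<^sub>m (T_mat M * K)) *\<^sub>v vCons t v - G *\<^sub>v vCons t v"
      unfolding W_def using T K G z by (intro minus_mult_distrib_mat_vec) auto
    moreover have "(b_coef chi \<cdot>\<^sub>m (T_mat M * K)) *\<^sub>v vCons t v = ?A (K *\<^sub>v vCons t v)"
      using T K z by (simp add: smult_mat_mult_vec[of _ "n + 1" "n + 1"])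
    ultimately show ?thesis
      by simp
  qed
  have c: "c_r M \<in> carrier_vec (n + 1)"
    by (simp add: c_r_def eq)
  have system_iff: "q2 \<cdot>\<^sub>v c_r M
      + E_mat M *\<^sub>v (diag_block_mat [0\<^sub>m 1 1, M0 M] *\<^sub>v vCons t (Rodd *\<^sub>v v))
    = b_coef chi \<cdot>\<^sub>v (E_mat M *\<^sub>v (T_mat M *\<^sub>v vCons t (Reven *\<^sub>v v)))
    \<longleftrightarrow> W *\<^sub>v vCons t v = q2 \<cdot>\<^sub>v c_r M" if v: "v \<in> carrier_vec n" for t v
  proof -
    have "diag_block_mat [0\<^sub>m 1 1, M0 M] *\<^sub>v vCons t (Rodd *\<^sub>v v) = vCons 0 (M0 M *\<^sub>v (Rodd *\<^sub>v v))"
      using d(2) M0 v by (subst diag_block_mat_pair_mult_vCons[of _ _ n n]) auto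
    moreover have "vCons 0 (M0 M *\<^sub>v (Rodd *\<^sub>v v)) \<in> carrier_vec (n + 1)"
      "T_mat M *\<^sub>v vCons t (Reven *\<^sub>v v) \<in> carrier_vec (n + 1)"
      using d M0 v T by auto
    moreover have "E_mat M = 1\<^sub>m (n + 1)"
      using E_mat_eq_one eq by simp
    ultimately show ?thesis
      using c vec_add_eq_iff[of "q2 \<cdot>\<^sub>v c_r M" "n + 1" "vCons 0 (M0 M *\<^sub>v (Rodd *\<^sub>v v))"
          "?A (vCons t (Reven *\<^sub>v v))"]
      unfolding W_vCons[OF v] by (simp del: diag_block_mat.simps)
  qed
  have "\<exists>!z. z \<in> carrier_vec (n + 1) \<and> W *\<^sub>v z = q2 \<cdot>\<^sub>v c_r M"
  proof (rule ex1_solution_if_trivial_kernel[OF W])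
    fix z
    assume z: "z \<in> carrier_vec (n + 1)" and ker: "W *\<^sub>v z = 0\<^sub>v (n + 1)"
    then obtain t v where tv: "z = vCons t v" "v \<in> carrier_vec n"
      by (cases z) auto
    have "?A (vCons t (Reven *\<^sub>v v)) = vCons 0 (M0 M *\<^sub>v (Rodd *\<^sub>v v))"
      using ker W_vCons[OF tv(2), of t] d M0 tv T by (auto simp: vec_eq_iff)
    from system_matrix_trivial_kernel[OF M eq b assms(5) tv(2) this]
    show "z = 0\<^sub>v (n + 1)"
      by (simp add: tv zero_vec_Suc)
  qed (use c in simp)
  then obtain z where z: "z \<in> carrier_vec (n + 1)" "W *\<^sub>v z = q2 \<cdot>\<^sub>v c_r M"
    and uniq: "\<And>z'. z' \<in> carrier_vec (n + 1) \<Longrightarrow> W *\<^sub>v z' = q2 \<cdot>\<^sub>v c_r M \<Longrightarrow> z' = z"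
    by blast
  obtain t v where tv: "z = vCons t v" "v \<in> carrier_vec n"
    using z(1) by (cases z) auto
  show ?thesis
    unfolding n_def[symmetric]
  \<comment> \<open>The system sees only the difference \<open>\<theta> - \<theta>W\<close>, so
    \<open>\<theta>W\<close> is added back to the scalar entry of the solution.\<close>
  proof (rule ex1I[of _ "(t + \<theta>W, v)"], goal_cases)
    case 1
    then show ?case
      using z(2) tv system_iff[OF tv(2), of t] by simp
  next
    case (2 p)
    obtain \<theta> w where p: "p = (\<theta>, w)"
      by (cases p)
    have w: "w \<in> carrier_vec n"
      using 2 unfolding p by simp
    moreover have "W *\<^sub>v vCons (\<theta> - \<theta>W) w = q2 \<cdot>\<^sub>v c_r M"
      using 2 system_iff[OF w] unfolding p by blast
    ultimately have "vCons (\<theta> - \<theta>W) w = z"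
      by (intro uniq) simp_all
    then show ?case
      unfolding p tv by simp
  qed
qed

end
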